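(* For an MDP $\mathcal{M}$ and $\epsilon>0$, the gap-visitation complexity $\mathcal{C}(\mathcal{M},\epsilon)$ satisfies the following bounds: 1. $\displaystyle \mathcal{C}(\mathcal{M},\epsilon)\le \frac{H^3SA}{\epsilon^2}$; 2. $\displaystyle \mathcal{C}(\mathcal{M},\epsilon)\le\sum_{h=1}^H\sum_{s,a}\min\Big\{\frac{1}{W_h(s)\widetilde\Delta_h(s,a)^2},\frac{W_h(s)}{\epsilon^2}\Big\}+\frac{H^2|\mathrm{OPT}(\epsilon)|}{\epsilon^2}$; 3. $\displaystyle \mathcal{C}(\mathcal{M},\epsilon)\le\sum_{h=1}^H\sum_{s,a}\frac{1}{\epsilon\max\{\widetilde\Delta_h(s,a),\epsilon\}}+\frac{H^2|\mathrm{OPT}(\epsilon)|}{\epsilon^2}$.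
   Context: **MDPs.** $\mathcal{M}$ is a finite-horizon time-inhomogeneous MDP with $S$ states, $A$ actions, horizon $H$, initial distribution $P_0$, transition kernels $P_h$, and rewards in $[0,1]$. Policies are (possibly stochastic) maps $\pi:\mathcal{S}\times[H]\to\triangle(\mathcal{A})$. $Q_h^\star,V_h^\star$ are the optimal action-value and value functions, $\Delta_h(s,a)=V_h^\star(s)-Q_h^\star(s,a)$. An action is optimal at $(s,h)$ if $\Delta_h(s,a)=0$. $\Delta_{\min}(s,h)=\min_{a:\Delta_h(s,a)>0}\Delta_h(s,a)$ (with $\min\emptyset=+\infty$, relevant only if there is a single action). $\widetilde\Delta_h(s,a)$ equals $\Delta_h(s,a)$ if $\Delta_h(s,a)>0$; $\Delta_{\min}(s,h)$ if $a$ is the unique optimal action at $(s,h)$; $0$ if $a$ is one of several optimal actions at $(s,h)$. $w_h^\pi(s,a)=\mathbb{P}_\pi[s_h=s,a_h=a]$, $W_h(s)=\sup_\pi\mathbb{P}_\pi[s_h=s]$. **Gap-visitation complexity.** $$\mathcal{C}(\mathcal{M},\epsilon)=\sum_{h=1}^H\inf_\pi\max_{s,a}\min\Big\{\frac{1}{w_h^\pi(s,a)\widetilde\Delta_h(s,a)^2},\frac{W_h(s)^2}{w_h^\pi(s,a)\epsilon^2}\Big\}+\frac{H^2|\mathrm{OPT}(\epsilon)|}{\epsilon^2},$$ with $\mathrm{OPT}(\epsilon)=\{(s,a,h):\epsilon\ge W_h(s)\widetilde\Delta_h(s,a)/3\}$ and infima over all deterministic and stochastic policies. If $W_h(s)=0$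 then $W_h(s)^2/(w_h^\pi(s,a)\epsilon^2)$ is taken to be $0$; otherwise $1/0=+\infty$.
   Formalization: Bound 1 is false as printed (H=S=1, A=2, zero rewards: C = 4/ε² > 2/ε²); it is proved with the extra term HSA/ε², i.e. C ≤ H³SA/ε² + HSA/ε², which is attained when S=1, rewards are zero and A≥2. *)

theory Defs
  imports "HOL-Probability.Probability"
begin

record ('s, 'a) mdp =
  horizon :: nat
  init :: "'s pmf"
  kernel :: "nat \<Rightarrow> 's \<Rightarrow> 'a \<Rightarrow> 's pmf"
  reward :: "nat \<Rightarrow> 's \<Rightarrow> 'a \<Rightarrow> real"

text \<open>Steps are numbered \<open>1, \<dots>, horizon M\<close>. The first state is drawn from \<open>init M\<close>, and
  \<open>kernel M h s a\<close> is the law of the state at step \<open>h + 1\<close>. The number \<open>reward M h s a\<close> is the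
  (mean) reward; the value functions depend on the rewards only through their means. The state
  and action spaces are the finite types \<open>'s\<close> and \<open>'a\<close>.\<close>

definition wf_mdp :: "('s::finite, 'a::finite) mdp \<Rightarrow> bool" where
  "wf_mdp M \<longleftrightarrow> 1 \<le> horizon M \<and> (\<forall>h\<in>{1..horizon M}. \<forall>s a. reward M h s a \<in> {0..1})"

text \<open>Policies are Markov and stochastic; a deterministic policy is one whose values are
  \<open>return_pmf\<close>s.\<close>

type_synonym ('s, 'a) policy = "nat \<Rightarrow> 's \<Rightarrow> 'a pmf"

text \<open>Law of the \<open>n + 1\<close> state-action pairs at steps \<open>h, \<dots>, h + n\<close>, started in the pair
  \<open>(s, a)\<close> at step \<open>h\<close> and following \<open>\<pi>\<close> afterwards.\<close>

primrec rollout ::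
    "('s, 'a) mdp \<Rightarrow> ('s, 'a) policy \<Rightarrow> nat \<Rightarrow> nat \<Rightarrow> 's \<Rightarrow> 'a \<Rightarrow> ('s \<times> 'a) list pmf" where
  "rollout M \<pi> 0 h s a = return_pmf [(s, a)]"
| "rollout M \<pi> (Suc n) h s a =
     bind_pmf (kernel M h s a) (\<lambda>s'.
     bind_pmf (\<pi> (Suc h) s') (\<lambda>a'.
     map_pmf (\<lambda>\<tau>. (s, a) # \<tau>) (rollout M \<pi> n (Suc h) s' a')))"

definition trajectory :: "('s, 'a) mdp \<Rightarrow> ('s, 'a) policy \<Rightarrow> ('s \<times> 'a) list pmf" where
  "trajectory M \<pi> =
     bind_pmf (init M) (\<lambda>s. bind_pmf (\<pi> 1 s) (\<lambda>a. rollout M \<pi> (horizon M - 1) 1 s a))"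

text \<open>The list index of step \<open>h\<close> in a full trajectory is \<open>h - 1\<close>.\<close>

definition sa_visit :: "('s, 'a) mdp \<Rightarrow> ('s, 'a) policy \<Rightarrow> nat \<Rightarrow> 's \<Rightarrow> 'a \<Rightarrow> real" where
  "sa_visit M \<pi> h s a = measure_pmf.prob (trajectory M \<pi>) {\<tau>. \<tau> ! (h - 1) = (s, a)}"

definition s_visit :: "('s, 'a) mdp \<Rightarrow> ('s, 'a) policy \<Rightarrow> nat \<Rightarrow> 's \<Rightarrow> real" where
  "s_visit M \<pi> h s = measure_pmf.prob (trajectory M \<pi>) {\<tau>. fst (\<tau> ! (h - 1)) = s}"

definition max_visit :: "('s, 'a) mdp \<Rightarrow> nat \<Rightarrow> 's \<Rightarrow> real" where
  "max_visit M h s = (SUP \<pi>. s_visit M \<pi> h s)"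

definition Q_pi :: "('s, 'a) mdp \<Rightarrow> ('s, 'a) policy \<Rightarrow> nat \<Rightarrow> 's \<Rightarrow> 'a \<Rightarrow> real" where
  "Q_pi M \<pi> h s a =
     measure_pmf.expectation (rollout M \<pi> (horizon M - h) h s a)
       (\<lambda>\<tau>. \<Sum>i<length \<tau>. reward M (h + i) (fst (\<tau> ! i)) (snd (\<tau> ! i)))"

definition V_pi :: "('s, 'a) mdp \<Rightarrow> ('s, 'a) policy \<Rightarrow> nat \<Rightarrow> 's \<Rightarrow> real" where
  "V_pi M \<pi> h s = measure_pmf.expectation (\<pi> h s) (Q_pi M \<pi> h s)"

definition Q_opt :: "('s, 'a) mdp \<Rightarrow> nat \<Rightarrow> 's \<Rightarrow> 'a \<Rightarrow> real" where
  "Q_opt M h s a = (SUP \<pi>. Q_pi M \<pi> h s a)"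

definition V_opt :: "('s, 'a) mdp \<Rightarrow> nat \<Rightarrow> 's \<Rightarrow> real" where
  "V_opt M h s = (SUP \<pi>. V_pi M \<pi> h s)"

definition gap :: "('s, 'a) mdp \<Rightarrow> nat \<Rightarrow> 's \<Rightarrow> 'a \<Rightarrow> real" where
  "gap M h s a = V_opt M h s - Q_opt M h s a"

definition opt_actions :: "('s, 'a) mdp \<Rightarrow> nat \<Rightarrow> 's \<Rightarrow> 'a set" where
  "opt_actions M h s = {a. gap M h s a = 0}"

text \<open>The minimum of the positive gaps, where the minimum of the empty set is \<open>\<top> = \<infinity>\<close>.\<close>

definition min_gap :: "('s, 'a::finite) mdp \<Rightarrow> nat \<Rightarrow> 's \<Rightarrow> ennreal" where
  "min_gap M h s = (INF a\<in>{a. gap M h s a > 0}. ennreal (gap M h s a))"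

definition eff_gap :: "('s, 'a::finite) mdp \<Rightarrow> nat \<Rightarrow> 's \<Rightarrow> 'a \<Rightarrow> ennreal" where
  "eff_gap M h s a =
     (if gap M h s a > 0 then ennreal (gap M h s a)
      else if opt_actions M h s = {a} then min_gap M h s
      else 0)"

text \<open>The extended nonnegative reals supply the conventions needed for degenerate terms:
  \<open>1 / 0 = \<infinity>\<close>, \<open>0 / 0 = 0\<close> (used when \<open>max_visit M h s = 0\<close>), \<open>1 / \<infinity> = 0\<close> and
  \<open>0 * \<infinity> = 0\<close>.\<close>

definition OPT :: "('s::finite, 'a::finite) mdp \<Rightarrow> real \<Rightarrow> ('s \<times> 'a \<times> nat) set" where
  "OPT M \<epsilon> = {(s, a, h). h \<in> {1..horizon M} \<and>
     ennreal \<epsilon> \<ge> ennreal (max_visit M h s) * eff_gap M h s a / 3}"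

definition OPT_term :: "('s::finite, 'a::finite) mdp \<Rightarrow> real \<Rightarrow> ennreal" where
  "OPT_term M \<epsilon> = of_nat ((horizon M)\<^sup>2 * card (OPT M \<epsilon>)) / (ennreal \<epsilon>)\<^sup>2"

definition gap_visitation :: "('s::finite, 'a::finite) mdp \<Rightarrow> real \<Rightarrow> ennreal" where
  "gap_visitation M \<epsilon> =
     (\<Sum>h=1..horizon M. INF \<pi>. MAX (s, a)\<in>UNIV.
        min (1 / (ennreal (sa_visit M \<pi> h s a) * (eff_gap M h s a)\<^sup>2))
            ((ennreal (max_visit M h s))\<^sup>2 / (ennreal (sa_visit M \<pi> h s a) * (ennreal \<epsilon>)\<^sup>2)))
     + OPT_term M \<epsilon>"

text \<open>With \<open>H\<close>, \<open>S\<close>, \<open>A\<close> the horizon and the numbers of states and actions, \<open>OPT_term\<close> alone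
  can be as large as \<open>H^3 * S * A / \<epsilon>^2\<close>, and the sum over \<open>h\<close> then adds a positive amount:
  with one state, all rewards \<open>0\<close> and \<open>A \<ge> 2\<close>, the total is
  \<open>H^3 * A / \<epsilon>^2 + H * A / \<epsilon>^2\<close>. A worst-case bound
  therefore has to include the lower-order term \<open>H * S * A / \<epsilon>^2\<close>.\<close>

end

theory Submission
  imports Defs
begin

text \<open>The laws of \<open>(s\<^sub>h, a\<^sub>h)\<close> under Markov policies form a convex set: a mixture of such laws
  is disintegrated into its state marginal and its conditional action laws, and the latter define
  a Markov policy that reproduces the mixture at every step. Hence, for any weights
  \<open>\<mu>\<close> on state-action pairs, mixing policies that (almost) maximise the probability
  of reaching \<open>s\<close> at step \<open>h\<close> and then play \<open>a\<close> gives
  \<open>w\<^sub>h(s, a) \<ge> \<mu>(s, a) W\<^sub>h(s)\<close>, up to an arbitrarily small loss. Taking \<open>\<mu>\<close> proportional to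
  \<open>c(s, a) = min (1 / (W\<^sub>h(s) \<Delta>\<^sup>2)) (W\<^sub>h(s) / \<epsilon>\<^sup>2)\<close> equalises the terms of the maximum and bounds
  it by \<open>\<Sum> c(s, a)\<close>, which is the second bound. The other two follow by bounding each
  \<open>c(s, a)\<close>.\<close>

section \<open>Occupancies as one-step marginals of the trajectory law\<close>

definition transition :: "('s, 'a) mdp \<Rightarrow> ('s, 'a) policy \<Rightarrow> nat \<Rightarrow> 's \<times> 'a \<Rightarrow> ('s \<times> 'a) pmf" where
  "transition M \<pi> h x =
     bind_pmf (kernel M h (fst x) (snd x)) (\<lambda>s. map_pmf (Pair s) (\<pi> (Suc h) s))"

text \<open>The index is that of the trajectory list: \<open>occupancy M \<pi> n\<close> is the law of the pair at step
  \<open>n + 1\<close>.\<close>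

primrec occupancy :: "('s, 'a) mdp \<Rightarrow> ('s, 'a) policy \<Rightarrow> nat \<Rightarrow> ('s \<times> 'a) pmf" where
  "occupancy M \<pi> 0 = bind_pmf (init M) (\<lambda>s. map_pmf (Pair s) (\<pi> 1 s))"
| "occupancy M \<pi> (Suc n) = bind_pmf (occupancy M \<pi> n) (transition M \<pi> (Suc n))"

lemma rollout_Suc_transition:
  "rollout M \<pi> (Suc n) h s a =
     bind_pmf (transition M \<pi> h (s, a))
       (\<lambda>x. map_pmf (\<lambda>\<tau>. (s, a) # \<tau>) (rollout M \<pi> n (Suc h) (fst x) (snd x)))"
  by (simp add: transition_def bind_assoc_pmf bind_map_pmf)

lemma map_nth_0_rollout: "map_pmf (\<lambda>\<tau>. \<tau> ! 0) (rollout M \<pi> n h s a) = return_pmf (s, a)"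
  by (cases n) (simp_all add: map_bind_pmf pmf.map_comp o_def map_pmf_const)

text \<open>The Markov property. \<open>rollout\<close> recurses at the front of the list and
  \<open>occupancy\<close> at the last pair, so the induction peels off the first pair on both sides
  and compares the remaining rollouts.\<close>

lemma map_nth_Suc_rollout:
  "k < n \<Longrightarrow> map_pmf (\<lambda>\<tau>. \<tau> ! Suc k) (rollout M \<pi> n h s a) =
     bind_pmf (map_pmf (\<lambda>\<tau>. \<tau> ! k) (rollout M \<pi> n h s a)) (transition M \<pi> (h + k))"
proof (induction k arbitrary: n h s a)
  case 0
  then obtain n' where n: "n = Suc n'" using gr0_conv_Suc by auto
  have "map_pmf (\<lambda>\<tau>. \<tau> ! Suc 0) (rollout M \<pi> n h s a) =
      bind_pmf (transition M \<pi> h (s, a))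
        (\<lambda>x. map_pmf (\<lambda>\<tau>. \<tau> ! 0) (rollout M \<pi> n' (Suc h) (fst x) (snd x)))"
    unfolding n rollout_Suc_transition by (simp add: map_bind_pmf pmf.map_comp o_def)
  then show ?case
    unfolding map_nth_0_rollout by (simp add: bind_return_pmf bind_return_pmf')
next
  case (Suc k)
  then obtain n' where n: "n = Suc n'" and k: "k < n'" by (cases n) auto
  have shift: "map_pmf (\<lambda>\<tau>. \<tau> ! Suc j) (rollout M \<pi> n h s a) =
      bind_pmf (transition M \<pi> h (s, a))
        (\<lambda>x. map_pmf (\<lambda>\<tau>. \<tau> ! j) (rollout M \<pi> n' (Suc h) (fst x) (snd x)))" for j
    unfolding n rollout_Suc_transition by (simp add: map_bind_pmf pmf.map_comp o_def)
  show ?case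
    unfolding shift Suc.IH[OF k] by (simp add: bind_assoc_pmf)
qed

lemma map_nth_trajectory:
  "k < horizon M \<Longrightarrow> map_pmf (\<lambda>\<tau>. \<tau> ! k) (trajectory M \<pi>) = occupancy M \<pi> k"
proof (induction k)
  case 0
  show ?case
    unfolding trajectory_def map_bind_pmf map_nth_0_rollout by (simp add: map_pmf_def)
next
  case (Suc k)
  then have k: "k < horizon M - 1" by simp
  have "map_pmf (\<lambda>\<tau>. \<tau> ! Suc k) (trajectory M \<pi>) =
      bind_pmf (map_pmf (\<lambda>\<tau>. \<tau> ! k) (trajectory M \<pi>)) (transition M \<pi> (Suc k))"
    unfolding trajectory_def map_bind_pmf map_nth_Suc_rollout[OF k]
    by (simp add: bind_assoc_pmf)
  with Suc show ?case by simp
qed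

lemma sa_visit_eq_occupancy:
  assumes "h \<in> {1..horizon M}"
  shows "sa_visit M \<pi> h s a = pmf (occupancy M \<pi> (h - 1)) (s, a)"
proof -
  have "h - 1 < horizon M" using assms by auto
  from map_nth_trajectory[OF this, of \<pi>, symmetric] show ?thesis
    by (simp add: sa_visit_def pmf_map vimage_def)
qed

lemma s_visit_eq_occupancy:
  assumes "h \<in> {1..horizon M}"
  shows "s_visit M \<pi> h s = pmf (map_pmf fst (occupancy M \<pi> (h - 1))) s"
proof -
  have "h - 1 < horizon M" using assms by auto
  from map_nth_trajectory[OF this, of \<pi>, symmetric] show ?thesis
    by (simp add: s_visit_def pmf_map vimage_def pmf.map_comp)
qed

section \<open>Disintegration of occupancies and mixtures of Markov policies\<close>

lemma map_fst_transition [simp]: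
  "map_pmf fst (transition M \<pi> h x) = kernel M h (fst x) (snd x)"
  by (simp add: transition_def map_bind_pmf pmf.map_comp o_def map_pmf_const bind_return_pmf')

text \<open>The action at step \<open>Suc n\<close> is drawn from the current state alone, so the
  action law can be exchanged or identified separately from the state marginal.\<close>

lemma occupancy_factor:
  "occupancy M \<pi> n =
     bind_pmf (map_pmf fst (occupancy M \<pi> n)) (\<lambda>s. map_pmf (Pair s) (\<pi> (Suc n) s))"
proof (cases n)
  case 0
  then show ?thesis
    by (simp add: map_bind_pmf pmf.map_comp o_def map_pmf_const bind_return_pmf')
next
  case (Suc m)
  then show ?thesis
    by (simp add: map_bind_pmf bind_assoc_pmf) (simp add: transition_def[abs_def])
qed

lemma occupancy_cong:
  assumes "\<And>h. 1 \<le> h \<Longrightarrow> h \<le> Suc n \<Longrightarrow> \<pi> h = \<pi>' h"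
  shows "occupancy M \<pi> n = occupancy M \<pi>' n"
  using assms by (induction n) (auto simp: transition_def fun_eq_iff intro!: bind_pmf_cong)

text \<open>The state at list index \<open>n\<close> is drawn before the action of step
  \<open>Suc n\<close>, so agreement up to step \<open>n\<close> suffices.\<close>

lemma map_fst_occupancy_cong:
  assumes "\<And>h. 1 \<le> h \<Longrightarrow> h \<le> n \<Longrightarrow> \<pi> h = \<pi>' h"
  shows "map_pmf fst (occupancy M \<pi> n) = map_pmf fst (occupancy M \<pi>' n)"
proof (cases n)
  case 0
  then show ?thesis
    by (simp add: map_bind_pmf pmf.map_comp o_def map_pmf_const bind_return_pmf')
next
  case (Suc m)
  with assms have "occupancy M \<pi> m = occupancy M \<pi>' m" by (intro occupancy_cong) auto
  with Suc show ?thesis by (simp add: map_bind_pmf)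
qed

text \<open>Unspecified at states of probability \<open>0\<close>, which do not contribute to the binds below.\<close>

definition disintegration :: "('s \<times> 'a) pmf \<Rightarrow> 's \<Rightarrow> 'a pmf" where
  "disintegration p s = map_pmf snd (cond_pmf p {x. fst x = s})"

text \<open>The law of total probability: the first component is constantly \<open>s\<close> under
  the conditional law, so pairing \<open>s\<close> with the conditional action law restores
  it.\<close>

lemma bind_disintegration:
  "bind_pmf (map_pmf fst p) (\<lambda>s. map_pmf (Pair s) (disintegration p s)) = p"
proof -
  have "map_pmf (Pair s) (disintegration p s) = cond_pmf p {x. fst x = s}"
    if "s \<in> set_pmf (map_pmf fst p)" for s
  proof -
    have ne: "set_pmf p \<inter> {x. fst x = s} \<noteq> {}" using that by auto
    have "map_pmf (Pair s) (disintegration p s) =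
        map_pmf (\<lambda>x. x) (cond_pmf p {x. fst x = s})"
      unfolding disintegration_def pmf.map_comp
      by (intro map_pmf_cong) (auto simp: set_cond_pmf[OF ne])
    then show ?thesis by simp
  qed
  then have "bind_pmf (map_pmf fst p) (\<lambda>s. map_pmf (Pair s) (disintegration p s)) =
      bind_pmf (map_pmf fst p) (\<lambda>s. cond_pmf p {x. fst x = s})"
    by (intro bind_pmf_cong) auto
  also have "\<dots> = p"
    by (rule bind_cond_pmf_cancel) (auto simp: measure_map_pmf pmf_map vimage_def)
  finally show ?thesis .
qed

text \<open>The kernel does not depend on the policy, so the mixed law of the current pair already
  determines the next state marginal.\<close>

lemma map_fst_bind_occupancy_Suc:
  "map_pmf fst (bind_pmf \<mu> (\<lambda>i. occupancy M (\<rho> i) (Suc n))) =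
     bind_pmf (bind_pmf \<mu> (\<lambda>i. occupancy M (\<rho> i) n)) (\<lambda>x. kernel M (Suc n) (fst x) (snd x))"
  by (simp add: map_bind_pmf bind_assoc_pmf)

text \<open>A single policy serves all \<open>n\<close>: equal pair laws at \<open>n\<close> give
  equal state marginals at \<open>Suc n\<close>, and the disintegration supplies the action laws
  that rebuild the mixture there.\<close>

lemma mixture_occupancy:
  "\<exists>\<pi>. \<forall>n. occupancy M \<pi> n = bind_pmf \<mu> (\<lambda>i. occupancy M (\<rho> i) n)"
proof -
  define mix where "mix n = bind_pmf \<mu> (\<lambda>i. occupancy M (\<rho> i) n)" for n
  define \<pi> where "\<pi> h = disintegration (mix (h - 1))" for h
  have "occupancy M \<pi> n = mix n" for n
  proof (induction n)
    case 0
    have "map_pmf fst (mix 0) = init M"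
      by (simp add: mix_def map_bind_pmf pmf.map_comp o_def map_pmf_const bind_return_pmf')
    then show ?case
      using bind_disintegration[of "mix 0"] by (simp add: \<pi>_def)
  next
    case (Suc n)
    have "map_pmf fst (mix (Suc n)) = map_pmf fst (occupancy M \<pi> (Suc n))"
      using Suc map_fst_bind_occupancy_Suc[of \<mu> M \<rho> n]
      by (simp add: mix_def map_bind_pmf)
    moreover have "\<pi> (Suc (Suc n)) = disintegration (mix (Suc n))"
      by (simp add: \<pi>_def)
    ultimately show ?case
      using bind_disintegration[of "mix (Suc n)"] occupancy_factor[of M \<pi> "Suc n"]
      by metis
  qed
  then show ?thesis unfolding mix_def by blast
qed

section \<open>Policies nearly attaining the maximal visitation probabilities\<close>

lemma s_visit_le_1: "s_visit M \<pi> h s \<le> 1"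
  by (simp add: s_visit_def)

lemma s_visit_nonneg: "0 \<le> s_visit M \<pi> h s"
  by (simp add: s_visit_def)

lemma bdd_above_s_visit: "bdd_above (range (\<lambda>\<pi>. s_visit M \<pi> h s))"
  by (rule bdd_aboveI[of _ 1]) (auto simp: s_visit_le_1)

lemma max_visit_le_1: "max_visit M h s \<le> 1"
  unfolding max_visit_def by (rule cSUP_least) (auto simp: s_visit_le_1)

lemma max_visit_nonneg: "0 \<le> max_visit M h s"
  unfolding max_visit_def
  by (rule cSUP_upper2[OF bdd_above_s_visit, of undefined]) (auto simp: s_visit_nonneg)

text \<open>The loss is multiplicative, so any policy works where the maximal visitation is
  \<open>0\<close>, and the factor later separates from the mixture weights.\<close>

lemma exists_near_max_s_visit:
  assumes "t < 1"
  shows "\<exists>\<pi>. t * max_visit M h s \<le> s_visit M \<pi> h s"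
proof (cases "max_visit M h s = 0")
  case True
  then show ?thesis by (simp add: s_visit_nonneg)
next
  case False
  then have "t * max_visit M h s < 1 * max_visit M h s"
    using max_visit_nonneg[of M h s] assms by (intro mult_strict_right_mono) auto
  then have "t * max_visit M h s < (SUP \<pi>. s_visit M \<pi> h s)"
    by (simp add: max_visit_def)
  then obtain \<pi> where "t * max_visit M h s < s_visit M \<pi> h s"
    using less_cSUP_iff[OF _ bdd_above_s_visit[of M h s]] by auto
  then show ?thesis by (intro exI[of _ \<pi>]) simp
qed

lemma exists_near_max_sa_visit:
  assumes "t < 1" and h: "h \<in> {1..horizon M}"
  shows "\<exists>\<pi>. t * max_visit M h s \<le> sa_visit M \<pi> h s a"
proof -
  obtain \<pi> where \<pi>: "t * max_visit M h s \<le> s_visit M \<pi> h s"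
    using exists_near_max_s_visit[OF assms(1), of M h s] by blast
  \<comment> \<open>Overriding the action law at step \<open>h\<close> keeps the state law at step
    \<open>h\<close> and turns every visit to a state into a visit with action
    \<open>a\<close>.\<close>
  define \<pi>' where "\<pi>' = \<pi>(h := (\<lambda>_. return_pmf a))"
  have hn: "Suc (h - 1) = h" using h by simp
  have "map_pmf fst (occupancy M \<pi>' (h - 1)) = map_pmf fst (occupancy M \<pi> (h - 1))"
    using h by (intro map_fst_occupancy_cong) (auto simp: \<pi>'_def)
  then have "occupancy M \<pi>' (h - 1) =
      map_pmf (\<lambda>s. (s, a)) (map_pmf fst (occupancy M \<pi> (h - 1)))"
    by (subst occupancy_factor) (simp add: hn \<pi>'_def flip: map_pmf_def del: One_nat_def)
  then have "sa_visit M \<pi>' h s a =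
      pmf (map_pmf (\<lambda>s. (s, a)) (map_pmf fst (occupancy M \<pi> (h - 1)))) (s, a)"
    using sa_visit_eq_occupancy[OF h] by simp
  also have "\<dots> = s_visit M \<pi> h s"
    using s_visit_eq_occupancy[OF h]
      pmf_map_inj'[of "\<lambda>s. (s, a)" "map_pmf fst (occupancy M \<pi> (h - 1))" s]
    by (simp add: inj_def)
  finally show ?thesis using \<pi> by (intro exI[of _ \<pi>']) simp
qed

lemma exists_spread_policy:
  fixes M :: "('s::finite, 'a::finite) mdp"
  assumes "t < 1" and h: "h \<in> {1..horizon M}"
  shows "\<exists>\<pi>. \<forall>s a. pmf \<mu> (s, a) * (t * max_visit M h s) \<le> sa_visit M \<pi> h s a"
proof -
  have "\<forall>x. \<exists>\<pi>. t * max_visit M h (fst x) \<le> sa_visit M \<pi> h (fst x) (snd x)"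
    using exists_near_max_sa_visit[OF assms] by blast
  then obtain \<rho> where \<rho>: "\<And>x. t * max_visit M h (fst x) \<le> sa_visit M (\<rho> x) h (fst x) (snd x)"
    by metis
  obtain \<pi> where \<pi>: "\<And>n. occupancy M \<pi> n = bind_pmf \<mu> (\<lambda>x. occupancy M (\<rho> x) n)"
    using mixture_occupancy by blast
  have "pmf \<mu> (s, a) * (t * max_visit M h s) \<le> sa_visit M \<pi> h s a" for s a
  proof -
    have "pmf \<mu> (s, a) * (t * max_visit M h s) \<le> pmf \<mu> (s, a) * sa_visit M (\<rho> (s, a)) h s a"
      using \<rho>[of "(s, a)"] by (intro mult_left_mono) auto
    \<comment> \<open>The sum is the visitation probability under the mixture; its component at
      \<open>(s, a)\<close> is the one tuned to this pair.\<close>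
    also have "\<dots> \<le> (\<Sum>x\<in>UNIV. pmf \<mu> x * sa_visit M (\<rho> x) h s a)"
      by (rule member_le_sum) (auto simp: sa_visit_def)
    also have "\<dots> = sa_visit M \<pi> h s a"
      unfolding sa_visit_eq_occupancy[OF h] \<pi> pmf_bind
      by (subst integral_measure_pmf[of UNIV]) auto
    finally show ?thesis .
  qed
  then show ?thesis by blast
qed

section \<open>Balancing the terms of the maximum at a single step\<close>

lemma exists_pmf_proportional:
  fixes g :: "'b::finite \<Rightarrow> real"
  assumes "\<And>x. 0 < g x"
  shows "\<exists>\<mu>. \<forall>x. pmf \<mu> x = g x / (\<Sum>y\<in>UNIV. g y)"
proof -
  define G where "G = (\<Sum>y\<in>UNIV. g y)"
  have G: "0 < G" unfolding G_def using assms by (intro sum_pos) auto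
  have "pmf (embed_pmf (\<lambda>x. g x / G)) x = g x / G" for x
  proof (rule pmf_embed_pmf)
    show "0 \<le> g x / G" for x using assms[of x] G by simp
    then have "(\<integral>\<^sup>+x. ennreal (g x / G) \<partial>count_space UNIV) = ennreal (\<Sum>x\<in>UNIV. g x / G)"
      by (simp add: nn_integral_count_space_finite sum_ennreal)
    also have "(\<Sum>x\<in>UNIV. g x / G) = 1"
      using G by (simp flip: sum_divide_distrib add: G_def)
    finally show "(\<integral>\<^sup>+x. ennreal (g x / G) \<partial>count_space UNIV) = 1" by simp
  qed
  then show ?thesis unfolding G_def by blast
qed

lemma ennreal_inverse_antimono:
  fixes a b :: ennreal
  assumes "a \<le> b"
  shows "inverse b \<le> inverse a"
proof (cases "a = 0 \<or> b = \<top>")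
  case True
  then show ?thesis by auto
next
  case False
  with assms show ?thesis
    by (cases a b rule: ennreal2_cases)
      (auto simp: inverse_ennreal less_le top_unique intro!: ennreal_leI le_imp_inverse_le)
qed

text \<open>Both arguments of the minimum scale like \<open>1 / w\<close>, so a visitation of at
  least \<open>k * W\<close> costs a factor \<open>1 / k\<close> against \<open>w = W\<close>. The
  first estimate stays in \<open>ennreal\<close> since \<open>d\<close> may be \<open>0\<close> or
  infinite; the second is finite and reduces to reals.\<close>

lemma ennreal_visit_term_le:
  fixes d :: ennreal
  assumes "0 < W" "0 < k" "k * W \<le> w" "0 < \<epsilon>"
  shows "min (1 / (ennreal w * d\<^sup>2)) ((ennreal W)\<^sup>2 / (ennreal w * (ennreal \<epsilon>)\<^sup>2))
    \<le> ennreal (1 / k) * min (1 / (ennreal W * d\<^sup>2)) (ennreal W / (ennreal \<epsilon>)\<^sup>2)"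
proof -
  have kW: "0 < k * W" using assms by simp
  then have w: "0 < w" using assms by linarith
  have "1 / (ennreal w * d\<^sup>2) \<le> 1 / (ennreal k * (ennreal W * d\<^sup>2))"
    using assms unfolding divide_ennreal_def
    by (intro mult_left_mono ennreal_inverse_antimono)
      (auto simp: mult.assoc[symmetric] ennreal_mult'[symmetric] intro!: mult_right_mono ennreal_leI)
  also have "\<dots> = ennreal (1 / k) * (1 / (ennreal W * d\<^sup>2))"
    using assms by (simp add: divide_ennreal_def ennreal_inverse_mult' inverse_ennreal
        inverse_eq_divide[of k] )
  finally have 1: "1 / (ennreal w * d\<^sup>2) \<le> ennreal (1 / k) * (1 / (ennreal W * d\<^sup>2))" .
  have "W\<^sup>2 / (w * \<epsilon>\<^sup>2) \<le> W\<^sup>2 / (k * W * \<epsilon>\<^sup>2)"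
    using assms kW w by (intro divide_left_mono mult_right_mono) auto
  also have "\<dots> = (1 / k) * (W / \<epsilon>\<^sup>2)"
    using assms by (simp add: field_simps power2_eq_square)
  finally have "ennreal (W\<^sup>2 / (w * \<epsilon>\<^sup>2)) \<le> ennreal ((1 / k) * (W / \<epsilon>\<^sup>2))"
    by (rule ennreal_leI)
  moreover have "(ennreal W)\<^sup>2 / (ennreal w * (ennreal \<epsilon>)\<^sup>2) = ennreal (W\<^sup>2 / (w * \<epsilon>\<^sup>2))"
    using assms w by (simp add: ennreal_power divide_ennreal flip: ennreal_mult')
  moreover have "ennreal W / (ennreal \<epsilon>)\<^sup>2 = ennreal (W / \<epsilon>\<^sup>2)"
    using assms by (simp add: ennreal_power divide_ennreal)
  moreover have "ennreal ((1 / k) * (W / \<epsilon>\<^sup>2)) = ennreal (1 / k) * ennreal (W / \<epsilon>\<^sup>2)"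
    using assms by (intro ennreal_mult) auto
  ultimately have 2: "(ennreal W)\<^sup>2 / (ennreal w * (ennreal \<epsilon>)\<^sup>2)
      \<le> ennreal (1 / k) * (ennreal W / (ennreal \<epsilon>)\<^sup>2)"
    by simp
  show ?thesis using 1 2 by (auto simp: min_def)
qed

lemma step_visitation_le:
  fixes M :: "('s::finite, 'a::finite) mdp" and d :: "'s \<Rightarrow> 'a \<Rightarrow> ennreal"
  assumes h: "h \<in> {1..horizon M}" and \<epsilon>: "0 < \<epsilon>"
  shows "(INF \<pi>. MAX (s, a)\<in>UNIV.
        min (1 / (ennreal (sa_visit M \<pi> h s a) * (d s a)\<^sup>2))
            ((ennreal (max_visit M h s))\<^sup>2 / (ennreal (sa_visit M \<pi> h s a) * (ennreal \<epsilon>)\<^sup>2)))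
    \<le> (\<Sum>(s, a)\<in>UNIV. min (1 / (ennreal (max_visit M h s) * (d s a)\<^sup>2))
                          (ennreal (max_visit M h s) / (ennreal \<epsilon>)\<^sup>2))"
    (is "?L \<le> ?R")
proof -
  let ?W = "max_visit M h"
  let ?c = "\<lambda>s a. min (1 / (ennreal (?W s) * (d s a)\<^sup>2)) (ennreal (?W s) / (ennreal \<epsilon>)\<^sup>2)"
  define c where "c = (\<lambda>(s, a). enn2real (?c s a))"
  have c: "ennreal (c (s, a)) = ?c s a" for s a
  proof -
    \<comment> \<open>The second argument is finite even where \<open>d s a = 0\<close> makes the
      first infinite, so passing to a real \<open>c\<close> loses nothing.\<close>
    have "ennreal (?W s) / (ennreal \<epsilon>)\<^sup>2 < \<top>"
      using \<epsilon> max_visit_nonneg[of M h s] by (simp add: ennreal_power divide_ennreal)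
    then have "?c s a < \<top>" by (auto simp: min_less_iff_disj)
    then show ?thesis by (simp add: c_def)
  qed
  have c0: "0 \<le> c x" for x by (simp add: c_def split: prod.split)
  define C where "C = (\<Sum>x\<in>UNIV. c x)"
  define n where "n = real (CARD('s \<times> 'a))"
  have R: "?R = ennreal C"
  proof -
    have "?R = (\<Sum>x\<in>UNIV. ennreal (c x))"
      by (intro sum.cong refl) (auto simp: c)
    then show ?thesis unfolding C_def by (simp add: c0)
  qed
  \<comment> \<open>The slack \<open>\<eta>\<close> keeps every mixture weight positive, also where \<open>c\<close> vanishes because the
    effective gap is infinite, and covers suprema that might not be attained.\<close>
  have bound: "?L \<le> ennreal ((C + n * \<eta>) * (1 + \<eta>))" if \<eta>: "0 < \<eta>" for \<eta>
  proof -
    have sum: "(\<Sum>x\<in>UNIV. c x + \<eta>) = C + n * \<eta>"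
      by (simp add: C_def n_def sum.distrib)
    have pos: "0 < c x + \<eta>" for x using c0[of x] \<eta> by linarith
    obtain \<mu> where \<mu>: "\<And>x. pmf \<mu> x = (c x + \<eta>) / (C + n * \<eta>)"
      using exists_pmf_proportional[of "\<lambda>x. c x + \<eta>"] pos sum by auto
    have N: "0 < C + n * \<eta>" unfolding sum[symmetric] using pos by (intro sum_pos) auto
    have t: "1 / (1 + \<eta>) < 1" using \<eta> by simp
    obtain \<pi> where \<pi>: "\<And>s a. pmf \<mu> (s, a) * (1 / (1 + \<eta>) * ?W s) \<le> sa_visit M \<pi> h s a"
      using exists_spread_policy[OF t h] by blast
    have "min (1 / (ennreal (sa_visit M \<pi> h s a) * (d s a)\<^sup>2))
            ((ennreal (?W s))\<^sup>2 / (ennreal (sa_visit M \<pi> h s a) * (ennreal \<epsilon>)\<^sup>2))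
          \<le> ennreal ((C + n * \<eta>) * (1 + \<eta>))" for s a
    proof (cases "?W s = 0")
      case True
      \<comment> \<open>With numerator \<open>0\<close> the second argument is \<open>0\<close>
        whatever the visitation probability, by the convention \<open>0 / 0 = 0\<close>.\<close>
      then show ?thesis by (simp add: min.coboundedI2)
    next
      case False
      then have W: "0 < ?W s" using max_visit_nonneg[of M h s] by simp
      define k where "k = pmf \<mu> (s, a) * (1 / (1 + \<eta>))"
      have k: "0 < k" unfolding k_def \<mu> using pos[of "(s, a)"] N \<eta> by simp
      have "min (1 / (ennreal (sa_visit M \<pi> h s a) * (d s a)\<^sup>2))
            ((ennreal (?W s))\<^sup>2 / (ennreal (sa_visit M \<pi> h s a) * (ennreal \<epsilon>)\<^sup>2))
          \<le> ennreal (1 / k) * ennreal (c (s, a))"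
        unfolding c using \<pi>[of s a] W k \<epsilon>
        by (intro ennreal_visit_term_le) (auto simp: k_def mult.assoc)
      also have "\<dots> = ennreal (1 / k * c (s, a))"
        using k c0 by (intro ennreal_mult[symmetric]) auto
      \<comment> \<open>The weight in \<open>k\<close> is proportional to
        \<open>c (s, a) + \<eta>\<close>; dividing by it cancels \<open>c (s, a)\<close> up to a
        ratio below \<open>1\<close> and leaves a bound common to all pairs.\<close>
      also have "1 / k * c (s, a) = (C + n * \<eta>) * (1 + \<eta>) * (c (s, a) / (c (s, a) + \<eta>))"
        unfolding k_def \<mu> by simp
      also have "\<dots> \<le> (C + n * \<eta>) * (1 + \<eta>) * 1"
        using N \<eta> pos[of "(s, a)"] c0[of "(s, a)"] by (intro mult_left_mono) auto
      finally show ?thesis by (simp add: ennreal_leI)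
    qed
    then show ?thesis
      by (intro INF_lower2[of \<pi>]) (auto intro!: Max.boundedI)
  qed
  \<comment> \<open>Letting the slack tend to \<open>0\<close> from above removes it from the
    bound.\<close>
  have "((\<lambda>\<eta>. ennreal ((C + n * \<eta>) * (1 + \<eta>))) \<longlongrightarrow> ennreal ((C + n * 0) * (1 + 0))) (at_right 0)"
    by (intro tendsto_intros)
  moreover have "eventually (\<lambda>\<eta>. ?L \<le> ennreal ((C + n * \<eta>) * (1 + \<eta>))) (at_right 0)"
    using bound by (auto simp: eventually_at_right_less intro: eventually_mono[OF eventually_at_right_less])
  ultimately have "?L \<le> ennreal ((C + n * 0) * (1 + 0))"
    by (intro tendsto_lowerbound) auto
  then show ?thesis unfolding R by simp
qed

section \<open>Pointwise estimates and the three bounds\<close>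

lemma min_le_inverse_max:
  fixes d :: ennreal
  assumes W: "0 \<le> W" "W \<le> 1" and \<epsilon>: "0 < \<epsilon>"
  shows "min (1 / (ennreal W * d\<^sup>2)) (ennreal W / (ennreal \<epsilon>)\<^sup>2)
    \<le> 1 / (ennreal \<epsilon> * max d (ennreal \<epsilon>))"
proof (cases "W = 0")
  case True
  then show ?thesis by simp
next
  case False
  then have W0: "0 < W" using W by simp
  have eq: "ennreal W / (ennreal \<epsilon>)\<^sup>2 = ennreal (W / \<epsilon>\<^sup>2)"
    using W \<epsilon> by (simp add: ennreal_power divide_ennreal)
  show ?thesis
  proof (cases d)
    case top
    \<comment> \<open>An infinite gap makes the first argument \<open>0\<close>, because
      \<open>W\<close> is positive.\<close>
    then show ?thesis using W0 by (simp add: ennreal_mult_top power2_eq_square)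
  next
    case (real r)
    show ?thesis
    proof (cases "r \<le> \<epsilon>")
      case True
      \<comment> \<open>For gaps up to \<open>\<epsilon>\<close> the second argument and
        \<open>W \<le> 1\<close> suffice.\<close>
      have "W / \<epsilon>\<^sup>2 \<le> 1 / (\<epsilon> * \<epsilon>)"
        using W \<epsilon> by (simp add: power2_eq_square divide_right_mono)
      then have "ennreal (W / \<epsilon>\<^sup>2) \<le> ennreal (1 / (\<epsilon> * \<epsilon>))" by (rule ennreal_leI)
      also have "\<dots> = 1 / (ennreal \<epsilon> * ennreal \<epsilon>)"
        using \<epsilon> by (simp add: divide_ennreal[symmetric] ennreal_mult')
      also have "\<dots> = 1 / (ennreal \<epsilon> * max d (ennreal \<epsilon>))"
        using True real by (simp add: max_def ennreal_leI)
      finally show ?thesis unfolding eq by (rule min.coboundedI2)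
    next
      case False
      then have r: "\<epsilon> < r" by simp
      have W2: "1 / (ennreal W * d\<^sup>2) = ennreal (1 / (W * r\<^sup>2))"
        using W0 r \<epsilon> real
        by (simp add: ennreal_power divide_ennreal[of 1, simplified] flip: ennreal_mult')
      \<comment> \<open>The right-hand side is the geometric mean of the two arguments of \<open>min\<close>.\<close>
      have "min (1 / (W * r\<^sup>2)) (W / \<epsilon>\<^sup>2) \<le> 1 / (\<epsilon> * r)"
      proof (cases "W * r \<le> \<epsilon>")
        case True
        then have "W / \<epsilon>\<^sup>2 \<le> 1 / (\<epsilon> * r)"
          using r \<epsilon> by (simp add: field_simps power2_eq_square)
        then show ?thesis by (rule min.coboundedI2)
      next
        case False
        then have "1 / (W * r\<^sup>2) \<le> 1 / (\<epsilon> * r)"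
          using r \<epsilon> W0 by (simp add: field_simps power2_eq_square)
        then show ?thesis by (rule min.coboundedI1)
      qed
      then have "ennreal (min (1 / (W * r\<^sup>2)) (W / \<epsilon>\<^sup>2)) \<le> ennreal (1 / (\<epsilon> * r))"
        by (rule ennreal_leI)
      moreover have "ennreal (1 / (\<epsilon> * r)) = 1 / (ennreal \<epsilon> * max d (ennreal \<epsilon>))"
        using r \<epsilon> real
        by (simp add: max_def ennreal_less_iff leD divide_ennreal[of 1, simplified] flip: ennreal_mult')
      ultimately have "ennreal (min (1 / (W * r\<^sup>2)) (W / \<epsilon>\<^sup>2))
          \<le> 1 / (ennreal \<epsilon> * max d (ennreal \<epsilon>))"
        by (rule back_subst)
      then show ?thesis unfolding eq W2 using r \<epsilon> W by (subst min_ennreal) auto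
    qed
  qed
qed

lemma OPT_term_le:
  fixes M :: "('s::finite, 'a::finite) mdp"
  shows "OPT_term M \<epsilon> \<le> of_nat (horizon M ^ 3 * CARD('s) * CARD('a)) / (ennreal \<epsilon>)\<^sup>2"
proof -
  have "OPT M \<epsilon> \<subseteq> UNIV \<times> UNIV \<times> {1..horizon M}" by (auto simp: OPT_def)
  then have "card (OPT M \<epsilon>) \<le> card ((UNIV :: 's set) \<times> (UNIV :: 'a set) \<times> {1..horizon M})"
    by (intro card_mono) auto
  also have "\<dots> = CARD('s) * CARD('a) * horizon M" by (simp add: card_cartesian_product)
  finally have "(horizon M)\<^sup>2 * card (OPT M \<epsilon>)
      \<le> (horizon M)\<^sup>2 * (CARD('s) * CARD('a) * horizon M)"
    by (rule mult_left_mono) simp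
  also have "\<dots> = horizon M ^ 3 * CARD('s) * CARD('a)"
    by (simp add: power2_eq_square power3_eq_cube)
  finally show ?thesis
    unfolding OPT_term_def by (intro divide_right_mono_ennreal of_nat_mono)
qed

text \<open>The infimum over policies is taken separately at every step, so the policies chosen for
  different steps need not be compatible.\<close>

lemma gap_visitation_le_max_visit:
  assumes "\<epsilon> > 0"
  shows "gap_visitation M \<epsilon>
       \<le> (\<Sum>h=1..horizon M. \<Sum>(s, a)\<in>UNIV.
            min (1 / (ennreal (max_visit M h s) * (eff_gap M h s a)\<^sup>2))
                (ennreal (max_visit M h s) / (ennreal \<epsilon>)\<^sup>2))
         + OPT_term M \<epsilon>"
  unfolding gap_visitation_def
  by (intro add_right_mono sum_mono step_visitation_le assms)

theorem proposition4:
  fixes M :: "('s::finite, 'a::finite) mdp" and \<epsilon> :: real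
  assumes "wf_mdp M" and "\<epsilon> > 0"
  shows
    "gap_visitation M \<epsilon>
       \<le> of_nat (horizon M ^ 3 * CARD('s) * CARD('a)) / (ennreal \<epsilon>)\<^sup>2
         + of_nat (horizon M * CARD('s) * CARD('a)) / (ennreal \<epsilon>)\<^sup>2
     \<and> gap_visitation M \<epsilon>
       \<le> (\<Sum>h=1..horizon M. \<Sum>(s, a)\<in>UNIV.
            min (1 / (ennreal (max_visit M h s) * (eff_gap M h s a)\<^sup>2))
                (ennreal (max_visit M h s) / (ennreal \<epsilon>)\<^sup>2))
         + OPT_term M \<epsilon>
     \<and> gap_visitation M \<epsilon>
       \<le> (\<Sum>h=1..horizon M. \<Sum>(s, a)\<in>UNIV.
            1 / (ennreal \<epsilon> * max (eff_gap M h s a) (ennreal \<epsilon>)))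
         + OPT_term M \<epsilon>"
proof (intro conjI)
  note bound = gap_visitation_le_max_visit[OF \<open>\<epsilon> > 0\<close>, of M]
  show "gap_visitation M \<epsilon>
       \<le> (\<Sum>h=1..horizon M. \<Sum>(s, a)\<in>UNIV.
            min (1 / (ennreal (max_visit M h s) * (eff_gap M h s a)\<^sup>2))
                (ennreal (max_visit M h s) / (ennreal \<epsilon>)\<^sup>2))
         + OPT_term M \<epsilon>"
    by (rule bound)
  show "gap_visitation M \<epsilon>
       \<le> (\<Sum>h=1..horizon M. \<Sum>(s, a)\<in>UNIV.
            1 / (ennreal \<epsilon> * max (eff_gap M h s a) (ennreal \<epsilon>)))
         + OPT_term M \<epsilon>"
    using \<open>\<epsilon> > 0\<close>
    by (intro order_trans[OF bound] add_right_mono sum_mono)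
      (auto intro!: min_le_inverse_max max_visit_nonneg max_visit_le_1)
  \<comment> \<open>Bounding the visitation by \<open>1\<close> in the second argument gives at most
    \<open>1 / \<epsilon>\<^sup>2\<close> per triple; summed, this is the lower-order summand of the
    worst-case bound, while the leading one counts all triples in \<open>OPT\<close>.\<close>
  have "min (1 / (ennreal (max_visit M h s) * (eff_gap M h s a)\<^sup>2))
        (ennreal (max_visit M h s) / (ennreal \<epsilon>)\<^sup>2) \<le> 1 / (ennreal \<epsilon>)\<^sup>2" for h s a
    using max_visit_le_1[of M h s]
    by (intro min.coboundedI2 divide_right_mono_ennreal) simp
  then have "(\<Sum>h=1..horizon M. \<Sum>(s, a)\<in>UNIV.
            min (1 / (ennreal (max_visit M h s) * (eff_gap M h s a)\<^sup>2))
                (ennreal (max_visit M h s) / (ennreal \<epsilon>)\<^sup>2))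
      \<le> (\<Sum>h=1..horizon M. \<Sum>(s, a)\<in>(UNIV :: ('s \<times> 'a) set). 1 / (ennreal \<epsilon>)\<^sup>2)"
    by (intro sum_mono) auto
  also have "\<dots> = of_nat (horizon M * CARD('s) * CARD('a)) / (ennreal \<epsilon>)\<^sup>2"
    by (simp add: divide_ennreal_def mult.assoc case_prod_unfold flip: UNIV_Times_UNIV)
  finally show "gap_visitation M \<epsilon>
       \<le> of_nat (horizon M ^ 3 * CARD('s) * CARD('a)) / (ennreal \<epsilon>)\<^sup>2
         + of_nat (horizon M * CARD('s) * CARD('a)) / (ennreal \<epsilon>)\<^sup>2"
    using bound OPT_term_le[of M \<epsilon>]
    by (subst add.commute) (auto intro: order_trans add_mono)
qed

end
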